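(* Let $(\Omega,d)$ be a compact metric space and let $T:\Omega\to\Omega$ be a homeomorphism that is ergodic with respect to some $T$-invariant Borel probability measure on $\Omega$. Suppose that the dynamical system $\{\Omega,T\}$ satisfies the topological repetition property (TRP). Then there exists a residual subset $\mathcal{F}$ of $C(\Omega)$ such that for every $f\in\mathcal{F}$ there exists a residual subset $\Omega_f$ of $\Omega$ with the property that, for every $\omega\in\Omega_f$, the function $\mathbb{Z}\to\mathbb{R}$, $n\mapsto f(T^n\omega)$, is a Gordon potential.
   Context: $C(\Omega)$ is the space of continuous functions $f:\Omega\to\mathbb{R}$ with the supremum norm. A subset of a topological space is residual if it contains a countable intersection of open dense subsets. $\mathbb{Z}_+$ denotes the positive integers. A sequence $\{\omega_n\}_{n\ge 0}$ in $\Omega$ satisfies the repetition property (RP) if for all $\varepsilon>0$ and $r\in\mathbb{Z}_+$ there exists $q\in\mathbb{Z}_+$ such that $d(\omega_n,\omega_{n+q})<\varepsilon$ for all $n\in\{0,1,\dots,rq\}$. $PRP(T)$ is the set of $\omega\in\Omega$ such that $\{T^n\omega\}_{n\ge0}$ satisfies RP. The system $\{\Omega,T\}$ satisfies TRP if $PRP(T)$ is dense in $\Omega$. A bounded function $V:\mathbb{Z}\to\mathbb{R}$ is a Gordon potential if there exist positive integers $T_m$ $(m\in\mathbb{Z}_+)$ with $T_m\to\infty$ and functions $V_m:\mathbb{Z}\to\mathbb{R}$ $(m\in\mathbb{Z}_+)$ with $V_m(n+T_m)=V_m(n)$ for all $n\in\mathbb{Z}$, such that (i) $\sup_{n,m}|V_m(n)|<\infty$,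 and (ii) there is $C>0$ with $\sup_{|n|\le 2T_m}|V_m(n)-V(n)|\le C m^{-T_m}$ for all $m\in\mathbb{Z}_+$. *)

theory Defs
  imports "HOL-Analysis.Analysis" "HOL-Probability.Probability_Measure"
begin

definition residual :: "'a::topological_space set \<Rightarrow> bool" where
  "residual S \<longleftrightarrow>
     (\<exists>\<G>. countable \<G> \<and> (\<forall>U\<in>\<G>. open U \<and> closure U = UNIV) \<and> \<Inter>\<G> \<subseteq> S)"

definition invariant_borel_prob :: "('a::topological_space \<Rightarrow> 'a) \<Rightarrow> 'a measure \<Rightarrow> bool" where
  "invariant_borel_prob T \<mu> \<longleftrightarrow>
     prob_space \<mu> \<and> sets \<mu> = sets borel \<and> T \<in> measurable \<mu> \<mu> \<and> distr \<mu> \<mu> T = \<mu>"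

definition ergodic :: "('a \<Rightarrow> 'a) \<Rightarrow> 'a measure \<Rightarrow> bool" where
  "ergodic T \<mu> \<longleftrightarrow>
     (\<forall>A\<in>sets \<mu>. T -` A \<inter> space \<mu> = A \<longrightarrow> measure \<mu> A = 0 \<or> measure \<mu> A = 1)"

(* Integer iterates; meaningful for bijective T only. *)
definition int_iterate :: "('a \<Rightarrow> 'a) \<Rightarrow> int \<Rightarrow> 'a \<Rightarrow> 'a" where
  "int_iterate T n = (if n \<ge> 0 then T ^^ nat n else inv T ^^ nat (- n))"

definition repetition_property :: "(nat \<Rightarrow> 'a::metric_space) \<Rightarrow> bool" where
  "repetition_property x \<longleftrightarrow>
     (\<forall>\<epsilon>>0. \<forall>r\<ge>1. \<exists>q\<ge>1. \<forall>n\<in>{0..r * q}. dist (x n) (x (n + q)) < \<epsilon>)"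

definition PRP :: "('a::metric_space \<Rightarrow> 'a) \<Rightarrow> 'a set" where
  "PRP T = {\<omega>. repetition_property (\<lambda>n. (T ^^ n) \<omega>)}"

definition TRP :: "('a::metric_space \<Rightarrow> 'a) \<Rightarrow> bool" where
  "TRP T \<longleftrightarrow> closure (PRP T) = UNIV"

(* The periods p m and the approximants W m are indexed by positive integers; their values at
   m = 0 are irrelevant. The supremum in the last clause is over a finite nonempty set. *)
definition gordon_potential :: "(int \<Rightarrow> real) \<Rightarrow> bool" where
  "gordon_potential V \<longleftrightarrow>
     bounded (range V) \<and>
     (\<exists>(p :: nat \<Rightarrow> nat) (W :: nat \<Rightarrow> int \<Rightarrow> real).
        (\<forall>m\<ge>1. p m \<ge> 1) \<and>
        filterlim p at_top sequentially \<and>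
        (\<forall>m\<ge>1. \<forall>n. W m (n + int (p m)) = W m n) \<and>
        bdd_above {\<bar>W m n\<bar> | m n. m \<ge> 1} \<and>
        (\<exists>C>0. \<forall>m\<ge>1.
           (SUP n\<in>{n. \<bar>n\<bar> \<le> 2 * int (p m)}. \<bar>W m n - V n\<bar>) \<le> C * real m powi (- int (p m))))"

end

theory Submission
  imports Defs
begin

text \<open>
  For \<open>n \<mapsto> f(T\<^sup>n\<omega>)\<close> to be a Gordon potential it suffices to have, for each \<open>m\<close>, one period \<open>q \<ge> m\<close> such that,
  for all \<open>\<bar>n\<bar> \<le> 2q\<close>, the value at \<open>n\<close> agrees up to \<open>m\<^sup>-\<^sup>q\<close> with the value at \<open>n mod q\<close>.  With a strict
  inequality this is an open condition on the pair \<open>(f, \<omega>)\<close>, because it involves only finitely many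
  iterates.  The proof shows that it is also a dense condition on pairs; the Kuratowski--Ulam theorem
  (\<open>Kuratowski_Ulam\<close>) then turns the residual set of pairs into a residual set of functions \<open>f\<close>, each
  with a residual set of points \<open>\<omega>\<close>.

  Density (\<open>periodic_window_near_PRP_point\<close>) is where the repetition property enters.  Approximate
  the given point by some \<open>\<omega>\<close> in \<open>PRP T\<close>, and let \<open>q\<close> be a repetition time for four repetitions and
  a small tolerance.  Along the orbit segment of length \<open>4q\<close>, points whose times are congruent mod
  \<open>q\<close> are close, so a uniformly continuous \<open>f\<close> nearly takes equal values at them.  If \<open>\<omega>\<close> is not
  periodic, the points of the segment are distinct and \<open>f\<close> can be perturbed slightly, by Tietze
  extension of a small correction on this finite set, so that the values become exactly
  \<open>q\<close>-periodic.  If \<open>\<omega>\<close> is periodic, a large multiple of its period works for \<open>f\<close> itself.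

  The window in the definition of a Gordon potential is centred, while repetition is about forward
  orbits, so the base point has to be moved to the middle of the segment, to \<open>T\<^sup>2\<^sup>q\<omega>\<close>.  This costs
  nothing: the repetition property itself says that \<open>T\<^sup>2\<^sup>q\<omega>\<close> is close to \<open>\<omega>\<close>.
\<close>

section \<open>Residual sets in products\<close>

lemma closure_eq_UNIV_iff_meets_open:
  "closure S = UNIV \<longleftrightarrow> (\<forall>U. open U \<longrightarrow> U \<noteq> {} \<longrightarrow> U \<inter> S \<noteq> {})"
proof
  assume "closure S = UNIV"
  then show "\<forall>U. open U \<longrightarrow> U \<noteq> {} \<longrightarrow> U \<inter> S \<noteq> {}"
    by (metis open_Int_closure_eq_empty inf_top_right)
next
  assume *: "\<forall>U. open U \<longrightarrow> U \<noteq> {} \<longrightarrow> U \<inter> S \<noteq> {}"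
  have "- closure S \<inter> S = {}"
    using closure_subset by blast
  then show "closure S = UNIV"
    using * by (metis closed_closure open_Compl double_compl compl_bot_eq)
qed

text \<open>
  A section of an open dense set \<open>G\<close> at \<open>x\<close> is open; it is dense as soon as it meets every member
  \<open>V\<close> of a countable basis.  For a fixed \<open>V\<close> the set of good \<open>x\<close> is the projection of
  \<open>G \<inter> (UNIV \<times> V)\<close>, which is open and dense, and only countably many pairs \<open>(G, V)\<close> occur.
\<close>

theorem Kuratowski_Ulam:
  fixes R :: "('a::topological_space \<times> 'b::topological_space) set" and B :: "'b set set"
  assumes B: "countable B" "topological_basis B"
    and R: "residual R"
  shows "residual {x. residual {y. (x, y) \<in> R}}"
proof -
  obtain \<G> where \<G>: "countable \<G>" "\<And>G. G \<in> \<G> \<Longrightarrow> open G" "\<And>G. G \<in> \<G> \<Longrightarrow> closure G = UNIV"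
    "\<Inter>\<G> \<subseteq> R"
    using R unfolding residual_def by blast
  define proj :: "('a \<times> 'b) set \<Rightarrow> 'b set \<Rightarrow> 'a set" where
    "proj G V = fst ` (G \<inter> (UNIV \<times> V))" for G V
  define \<U> where "\<U> = (\<lambda>(G, V). proj G V) ` (\<G> \<times> (B - {{}}))"
  have "countable \<U>"
    unfolding \<U>_def using \<G>(1) B(1) by (intro countable_image countable_SIGMA) auto
  moreover have "open U \<and> closure U = UNIV" if "U \<in> \<U>" for U
  proof -
    obtain G V where GV: "G \<in> \<G>" "V \<in> B" "V \<noteq> {}" "U = proj G V"
      using \<open>U \<in> \<U>\<close> unfolding \<U>_def by auto
    have "open V" using B(2) GV(2) by (rule topological_basis_open)
    then have "open U"
      unfolding GV proj_def by (intro open_image_fst open_Int open_Times \<G>(2) GV) auto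
    moreover have "A \<inter> U \<noteq> {}" if "open A" "A \<noteq> {}" for A
    proof -
      have "open (A \<times> V)" "A \<times> V \<noteq> {}"
        using that \<open>open V\<close> GV(3) by (auto intro: open_Times)
      then have "(A \<times> V) \<inter> G \<noteq> {}"
        using \<G>(3)[OF GV(1)] unfolding closure_eq_UNIV_iff_meets_open by blast
      then show ?thesis
        unfolding GV proj_def by force
    qed
    ultimately show ?thesis
      unfolding closure_eq_UNIV_iff_meets_open by blast
  qed
  moreover have "\<Inter>\<U> \<subseteq> {x. residual {y. (x, y) \<in> R}}"
  proof
    fix x assume x: "x \<in> \<Inter>\<U>"
    define sect where "sect G = {y. (x, y) \<in> G}" for G :: "('a \<times> 'b) set"
    have "open (sect G) \<and> closure (sect G) = UNIV" if "G \<in> \<G>" for G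
    proof
      have "open (Pair x -` G)"
        by (intro open_vimage \<G>(2) that continuous_intros)
      then show "open (sect G)"
        by (simp add: sect_def vimage_def)
      have "A \<inter> sect G \<noteq> {}" if A: "open A" "A \<noteq> {}" for A
      proof -
        obtain a where "a \<in> A" using A by blast
        then obtain V where V: "V \<in> B" "a \<in> V" "V \<subseteq> A"
          by (rule topological_basisE[OF B(2) A(1)])
        then have "proj G V \<in> \<U>"
          unfolding \<U>_def using \<open>G \<in> \<G>\<close> by auto
        then have "x \<in> proj G V" using x by blast
        then show ?thesis
          using V unfolding proj_def sect_def by force
      qed
      then show "closure (sect G) = UNIV"
        unfolding closure_eq_UNIV_iff_meets_open by blast
    qed
    moreover have "\<Inter>(sect ` \<G>) \<subseteq> {y. (x, y) \<in> R}"
      using \<G>(4) unfolding sect_def by blast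
    moreover have "countable (sect ` \<G>)"
      using \<G>(1) by simp
    ultimately have "residual {y. (x, y) \<in> R}"
      unfolding residual_def by blast
    then show "x \<in> {x. residual {y. (x, y) \<in> R}}"
      by simp
  qed
  ultimately show ?thesis
    unfolding residual_def[of "{x. residual {y. (x, y) \<in> R}}"] by (metis (no_types, lifting))
qed

lemma compact_metric_countable_basis:
  assumes "compact (UNIV :: 'a::metric_space set)"
  obtains B :: "'a::metric_space set set" where "countable B" "topological_basis B"
proof -
  have "\<forall>n. \<exists>k. finite k \<and> (UNIV :: 'a set) \<subseteq> (\<Union>x\<in>k. ball x (inverse (real (Suc n))))"
    using assms unfolding compact_eq_totally_bounded by simp
  then obtain k where k: "\<And>n. finite (k n)"
    "\<And>n. (UNIV :: 'a set) \<subseteq> (\<Union>x\<in>k n. ball x (inverse (real (Suc n))))"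
    by metis
  define B where "B = (\<Union>n. (\<lambda>x. ball x (inverse (real (Suc n)))) ` k n)"
  have "countable B"
    unfolding B_def using k(1) by (intro countable_UN) (auto intro: countable_finite)
  moreover have "topological_basis B"
  proof (rule topological_basisI)
    show "open B'" if "B' \<in> B" for B'
      using that unfolding B_def by auto
    fix O' :: "'a set" and x assume "open O'" "x \<in> O'"
    then obtain e where e: "e > 0" "ball x e \<subseteq> O'"
      by (meson open_contains_ball)
    then obtain n where n: "inverse (real (Suc n)) < e / 2"
      using reals_Archimedean[of "e / 2"] by auto
    obtain y where y: "y \<in> k n" "x \<in> ball y (inverse (real (Suc n)))"
      using k(2)[of n] by blast
    have "ball y (inverse (real (Suc n))) \<subseteq> ball x e"
    proof
      fix z assume "z \<in> ball y (inverse (real (Suc n)))"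
      then show "z \<in> ball x e"
        using y(2) n dist_triangle[of x z y] by (simp add: dist_commute)
    qed
    then show "\<exists>B'\<in>B. x \<in> B' \<and> B' \<subseteq> O'"
      using y e unfolding B_def by blast
  qed
  ultimately show ?thesis by (rule that)
qed

section \<open>Perturbing a function on a finite set\<close>

lemma prescribe_values_on_finite_set:
  fixes f0 :: "'a::metric_space \<Rightarrow>\<^sub>C real"
  assumes "finite S" "e \<ge> 0" and h: "\<And>x. x \<in> S \<Longrightarrow> \<bar>h x - f0 x\<bar> \<le> e"
  obtains f :: "'a \<Rightarrow>\<^sub>C real" where "dist f f0 \<le> e" "\<And>x. x \<in> S \<Longrightarrow> f x = h x"
proof -
  have "closedin euclidean S"
    using assms(1) by (simp add: finite_imp_closed)
  moreover have "normal_space (euclidean :: 'a topology)"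
    by (intro metrizable_imp_normal_space metrizable_space_euclidean)
  moreover have "continuous_map (subtopology euclidean S) euclideanreal (\<lambda>x. h x - f0 x)"
    using continuous_on_finite[OF assms(1)] by simp
  moreover have "(\<lambda>x. h x - f0 x) ` S \<subseteq> {-e..e}"
    using h by (fastforce simp: abs_le_iff)
  ultimately obtain g where g: "continuous_map euclidean euclideanreal g"
    "\<And>x. x \<in> S \<Longrightarrow> g x = h x - f0 x" "g ` topspace euclidean \<subseteq> {-e..e}"
    using Tietze_extension_closed_real_interval[of euclidean S "\<lambda>x. h x - f0 x" "-e" e] assms(2)
    by auto
  have bound: "\<bar>g x\<bar> \<le> e" for x
    using g(3) by (simp add: image_subset_iff abs_le_iff minus_le_iff)
  have "g \<in> bcontfun"
    using g(1) bound by (intro bcontfun_normI[of g e]) auto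
  then have app: "apply_bcontfun (Bcontfun g) = g"
    by (rule Bcontfun_inverse)
  show ?thesis
  proof (rule that)
    show "dist (f0 + Bcontfun g) f0 \<le> e"
      by (rule dist_bound) (simp add: app dist_real_def bound)
    show "(f0 + Bcontfun g) x = h x" if "x \<in> S" for x
      using g(2)[OF that] by (simp add: app)
  qed
qed

section \<open>Exactly periodic windows near points with the repetition property\<close>

lemma dist_mod_repetition_le:
  assumes "q \<ge> 1" and rep: "\<And>n. n \<le> r * q \<Longrightarrow> dist (x n) (x (n + q)) < e" and "n \<le> r * q"
  shows "dist (x n) (x (n mod q)) \<le> real (n div q) * e"
  using assms(3)
proof (induction n rule: less_induct)
  case (less n)
  show ?case
  proof (cases "n < q")
    case True
    then show ?thesis by simp
  next
    case False
    define k where "k = n - q"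
    have k: "n = k + q" "k < n" "k \<le> r * q"
      using False less.prems assms(1) by (auto simp: k_def)
    have "dist (x n) (x (n mod q)) \<le> dist (x k) (x (k + q)) + dist (x k) (x (k mod q))"
      using dist_triangle3[of "x n" "x (n mod q)" "x k"] k(1) by (simp add: dist_commute)
    also have "\<dots> \<le> e + real (k div q) * e"
      using rep[OF k(3)] less.IH[OF k(2,3)] by linarith
    also have "\<dots> = real (n div q) * e"
      using assms(1) k(1) by (simp add: algebra_simps)
    finally show ?thesis .
  qed
qed

lemma inj_orbit_if_not_periodic:
  assumes "inj T" and "\<And>q. q \<ge> 1 \<Longrightarrow> (T ^^ q) \<omega> \<noteq> \<omega>"
  shows "inj (\<lambda>n. (T ^^ n) \<omega>)"
proof (rule linorder_injI)
  fix i j :: nat assume "i < j"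
  show "(T ^^ i) \<omega> \<noteq> (T ^^ j) \<omega>"
  proof
    assume "(T ^^ i) \<omega> = (T ^^ j) \<omega>"
    also have "(T ^^ j) \<omega> = (T ^^ i) ((T ^^ (j - i)) \<omega>)"
      using \<open>i < j\<close> funpow_add[of i "j - i" T] by simp
    finally have "\<omega> = (T ^^ (j - i)) \<omega>"
      using inj_fn[OF assms(1), of i] by (simp add: inj_eq)
    then show False
      using assms(2)[of "j - i"] \<open>i < j\<close> by (metis Suc_leI One_nat_def zero_less_diff)
  qed
qed

text \<open>
  If \<open>\<omega>\<close> is periodic, take \<open>q\<close> to be a large multiple of its period and leave \<open>f0\<close> unchanged.
  Otherwise the segment consists of distinct points, so the values of \<open>f\<close> on it can be prescribed
  freely; those prescribed are close to the values of \<open>f0\<close> because points of the segment whose times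
  are congruent mod \<open>q\<close> are at most four repetition steps apart.  The repetition time exceeds \<open>m\<close>
  since the tolerance \<open>\<epsilon>\<close> is at most the distance from \<open>\<omega>\<close> to each of its first \<open>m\<close> iterates.
\<close>

lemma periodic_window_near_PRP_point:
  fixes f0 :: "'a::metric_space \<Rightarrow>\<^sub>C real"
  assumes comp: "compact (UNIV :: 'a set)" and "inj T" and "\<omega> \<in> PRP T" and "\<eta> > 0"
  obtains q and f :: "'a \<Rightarrow>\<^sub>C real" where "q \<ge> 1" "q \<ge> m" "dist f f0 < \<eta>"
    "dist ((T ^^ (2 * q)) \<omega>) \<omega> < \<eta>"
    "\<And>n. n \<le> 4 * q \<Longrightarrow> f ((T ^^ n) \<omega>) = f ((T ^^ (n mod q)) \<omega>)"
proof (cases "\<exists>p\<ge>1. (T ^^ p) \<omega> = \<omega>")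
  case True
  then obtain p where p: "p \<ge> 1" "(T ^^ p) \<omega> = \<omega>" by blast
  define q where "q = p * Suc m"
  have per: "(T ^^ q) \<omega> = \<omega>"
    using p(2) funpow_mod_eq[where f = T and x = \<omega> and n = p and m = q] by (simp add: q_def)
  have "(T ^^ (2 * q)) \<omega> = \<omega>"
    using funpow_mod_eq[where f = T and x = \<omega> and n = q and m = "2 * q", OF per] by simp
  moreover have "(T ^^ n) \<omega> = (T ^^ (n mod q)) \<omega>" for n
    using funpow_mod_eq[where f = T and x = \<omega> and n = q and m = n, OF per] by simp
  moreover have "m < q"
    using p(1) mult_le_mono1[of 1 p "Suc m"] by (simp add: q_def)
  ultimately show ?thesis
    using that[of q f0] \<open>\<eta> > 0\<close> by simp
next
  case False
  define x where "x n = (T ^^ n) \<omega>" for n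
  have "inj x"
    unfolding x_def using False \<open>inj T\<close> by (intro inj_orbit_if_not_periodic) auto
  have "uniformly_continuous_on UNIV f0"
    using comp by (intro compact_uniformly_continuous) auto
  then obtain \<delta> where \<delta>: "\<delta> > 0" "\<And>y z. dist y z < \<delta> \<Longrightarrow> dist (f0 y) (f0 z) < \<eta> / 2"
    unfolding uniformly_continuous_on_def using \<open>\<eta> > 0\<close>
    by (metis UNIV_I half_gt_zero)
  define \<epsilon> where "\<epsilon> = Min (insert (\<delta> / 5) (insert (\<eta> / 5) ((\<lambda>i. dist (x 0) (x i)) ` {1..m})))"
  have "\<epsilon> > 0"
    using \<delta>(1) \<open>\<eta> > 0\<close> \<open>inj x\<close> by (auto simp: \<epsilon>_def inj_eq)
  have \<epsilon>: "\<epsilon> \<le> \<delta> / 5" "\<epsilon> \<le> \<eta> / 5" "\<And>i. i \<in> {1..m} \<Longrightarrow> \<epsilon> \<le> dist (x 0) (x i)"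
    unfolding \<epsilon>_def by (intro Min_le; simp)+
  have "repetition_property x"
    using \<open>\<omega> \<in> PRP T\<close> unfolding PRP_def x_def by simp
  then have "\<exists>q\<ge>1. \<forall>n\<in>{0..4 * q}. dist (x n) (x (n + q)) < \<epsilon>"
    unfolding repetition_property_def using \<open>\<epsilon> > 0\<close> by simp
  then obtain q where q: "q \<ge> 1" "\<And>n. n \<le> 4 * q \<Longrightarrow> dist (x n) (x (n + q)) < \<epsilon>"
    by auto
  have "q > m"
  proof (rule ccontr)
    assume "\<not> q > m"
    then show False
      using q(1) q(2)[of 0] \<epsilon>(3)[of q] by simp
  qed
  have close: "dist (x n) (x (n mod q)) \<le> 4 * \<epsilon>" if "n \<le> 4 * q" for n
  proof -
    have "n div q \<le> 4"
      using that q(1) div_le_mono[of n "4 * q" q] by simp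
    then have "real (n div q) * \<epsilon> \<le> 4 * \<epsilon>"
      using \<open>\<epsilon> > 0\<close> by (intro mult_right_mono) auto
    then show ?thesis
      using dist_mod_repetition_le[of q 4 x \<epsilon> n] q that by fastforce
  qed
  \<comment> \<open>The time of a point of the segment is well defined by injectivity, so the prescription \<open>h\<close> is.\<close>
  define h where "h y = f0 (x (inv x y mod q))" for y
  have h: "h (x n) = f0 (x (n mod q))" for n
    using \<open>inj x\<close> by (simp add: h_def)
  have "\<bar>h y - f0 y\<bar> \<le> \<eta> / 2" if y: "y \<in> x ` {..4 * q}" for y
  proof -
    obtain n where n: "n \<le> 4 * q" "y = x n" using y by auto
    have "dist (x n) (x (n mod q)) < \<delta>"
      using close[OF n(1)] \<epsilon>(1) \<open>\<delta> > 0\<close> by linarith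
    then show ?thesis
      using \<delta>(2)[of "x n" "x (n mod q)"] by (simp add: n h dist_real_def abs_minus_commute)
  qed
  then obtain f :: "'a \<Rightarrow>\<^sub>C real" where f: "dist f f0 \<le> \<eta> / 2"
    "\<And>y. y \<in> x ` {..4 * q} \<Longrightarrow> f y = h y"
    using prescribe_values_on_finite_set[of "x ` {..4 * q}" "\<eta> / 2" h f0] \<open>\<eta> > 0\<close> by auto
  show ?thesis
  proof (rule that[of q f])
    show "q \<ge> 1" "q \<ge> m" using q(1) \<open>q > m\<close> by auto
    show "dist f f0 < \<eta>" using f(1) \<open>\<eta> > 0\<close> by linarith
    show "dist ((T ^^ (2 * q)) \<omega>) \<omega> < \<eta>"
      using close[of "2 * q"] \<epsilon>(2) \<open>\<eta> > 0\<close> by (simp add: x_def)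
    show "f ((T ^^ n) \<omega>) = f ((T ^^ (n mod q)) \<omega>)" if "n \<le> 4 * q" for n
    proof -
      have "n mod q \<le> 4 * q"
        using q(1) mod_less_divisor[of q n] by linarith
      then have "f (x n) = h (x n)" "f (x (n mod q)) = h (x (n mod q))"
        using that by (auto intro!: f(2))
      then show ?thesis
        by (simp add: h flip: x_def)
    qed
  qed
qed

section \<open>Two-sided orbits\<close>

lemma int_iterate_funpow:
  assumes "bij T" and "n + int k \<ge> 0"
  shows "int_iterate T n ((T ^^ k) \<omega>) = (T ^^ nat (n + int k)) \<omega>"
proof (cases "n \<ge> 0")
  case True
  then have "nat (n + int k) = nat n + k" by simp
  then show ?thesis
    using True by (simp add: int_iterate_def funpow_add)
next
  case False
  define j where "j = nat (- n)"
  have k: "k = j + nat (n + int k)"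
    using False assms(2) by (simp add: j_def)
  have "(inv T ^^ j) ((T ^^ j) y) = y" for y
    using inv_fn[OF assms(1), of j] bij_is_inj[OF bij_fn[OF assms(1), of j]]
    by (metis inv_f_f)
  then show ?thesis
    using False k by (metis (no_types, lifting) comp_apply funpow_add int_iterate_def j_def)
qed

lemma continuous_on_funpow:
  fixes f :: "'a::topological_space \<Rightarrow> 'a"
  assumes "continuous_on UNIV f"
  shows "continuous_on UNIV (f ^^ n)"
  by (induction n) (simp_all add: id_def o_def continuous_on_compose2[OF assms])

lemma continuous_on_int_iterate:
  assumes "homeomorphism UNIV UNIV T (inv T)"
  shows "continuous_on UNIV (int_iterate T n)"
proof -
  have "continuous_on UNIV T" "continuous_on UNIV (inv T)"
    using assms unfolding homeomorphism_def by blast+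
  then show ?thesis
    unfolding int_iterate_def by (cases "n \<ge> 0") (simp_all only: if_True if_False continuous_on_funpow)
qed

text \<open>Evaluation is jointly continuous because the first argument carries the uniform metric.\<close>

lemma continuous_on_bcontfun_eval:
  fixes g :: "'a::metric_space \<Rightarrow> 'a"
  assumes "continuous_on UNIV g"
  shows "continuous_on UNIV (\<lambda>p :: ('a \<Rightarrow>\<^sub>C real) \<times> 'a. apply_bcontfun (fst p) (g (snd p)))"
  unfolding continuous_on_eq_continuous_at[OF open_UNIV]
proof (intro ballI)
  fix p :: "('a \<Rightarrow>\<^sub>C real) \<times> 'a"
  obtain f \<omega> where p: "p = (f, \<omega>)" by (cases p)
  have "continuous_on UNIV (\<lambda>q :: ('a \<Rightarrow>\<^sub>C real) \<times> 'a. f (g (snd q)))"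
    by (intro continuous_on_compose2[OF continuous_on_apply_bcontfun[of UNIV f]]
        continuous_on_compose2[OF assms] continuous_intros) auto
  then have "((\<lambda>q :: ('a \<Rightarrow>\<^sub>C real) \<times> 'a. f (g (snd q))) \<longlongrightarrow> f (g \<omega>)) (at p)"
    unfolding continuous_on_eq_continuous_at[OF open_UNIV] continuous_at by (simp add: p)
  moreover have "((\<lambda>q. apply_bcontfun (fst q) (g (snd q)) - f (g (snd q))) \<longlongrightarrow> 0) (at p)"
  proof (rule Lim_null_comparison)
    show "\<forall>\<^sub>F q in at p. norm (apply_bcontfun (fst q) (g (snd q)) - f (g (snd q))) \<le> dist (fst q) f"
      by (intro always_eventually allI) (metis dist_bounded dist_norm)
    have "((\<lambda>q. dist (fst q) f) \<longlongrightarrow> dist (fst p) f) (at p)"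
      by (intro tendsto_intros)
    then show "((\<lambda>q. dist (fst q) f) \<longlongrightarrow> 0) (at p)"
      by (simp add: p)
  qed
  ultimately have "((\<lambda>q. f (g (snd q)) + (apply_bcontfun (fst q) (g (snd q)) - f (g (snd q))))
      \<longlongrightarrow> f (g \<omega>) + 0) (at p)"
    by (rule tendsto_add)
  then show "isCont (\<lambda>p :: ('a \<Rightarrow>\<^sub>C real) \<times> 'a. apply_bcontfun (fst p) (g (snd p))) p"
    unfolding continuous_at by (simp add: p)
qed

section \<open>Almost periodic windows\<close>

text \<open>Pairs form a single set so that the conditions are subsets of the product to which
  \<open>Kuratowski_Ulam\<close> applies; the strict inequality makes them open.\<close>

definition almost_periodic_window ::
    "('a::metric_space \<Rightarrow> 'a) \<Rightarrow> nat \<Rightarrow> real \<Rightarrow> (('a \<Rightarrow>\<^sub>C real) \<times> 'a) set"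
  where "almost_periodic_window T q \<delta> =
    {(f, \<omega>). \<forall>n\<in>{- 2 * int q..2 * int q}.
       \<bar>apply_bcontfun f (int_iterate T (n mod int q) \<omega>) - f (int_iterate T n \<omega>)\<bar> < \<delta>}"

lemma open_almost_periodic_window:
  assumes "homeomorphism UNIV UNIV T (inv T)"
  shows "open (almost_periodic_window T q \<delta>)"
proof -
  have "almost_periodic_window T q \<delta> = (\<Inter>n\<in>{- 2 * int q..2 * int q}.
      {p. \<bar>apply_bcontfun (fst p) (int_iterate T (n mod int q) (snd p)) - apply_bcontfun (fst p) (int_iterate T n (snd p))\<bar> < \<delta>})"
    unfolding almost_periodic_window_def by auto
  also have "open \<dots>"
    by (intro open_INT finite_atLeastAtMost_int ballI open_Collect_less continuous_intros
        continuous_on_bcontfun_eval continuous_on_int_iterate assms)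
  finally show ?thesis .
qed

text \<open>
  Recentring: exact periodicity along the forward segment of length \<open>4q\<close> starting at \<open>\<omega>\<close> is exact
  periodicity on the window of radius \<open>2q\<close> around \<open>T\<^sup>2\<^sup>q\<omega>\<close>.
\<close>

lemma almost_periodic_window_recentre:
  assumes "bij T" "q \<ge> 1" "\<delta> > 0"
    and per: "\<And>n. n \<le> 4 * q \<Longrightarrow> apply_bcontfun f ((T ^^ n) \<omega>) = f ((T ^^ (n mod q)) \<omega>)"
  shows "(f, (T ^^ (2 * q)) \<omega>) \<in> almost_periodic_window T q \<delta>"
proof -
  have eq: "f (int_iterate T n ((T ^^ (2 * q)) \<omega>)) = f ((T ^^ nat (n mod int q)) \<omega>)"
    if n: "n \<in> {- 2 * int q..2 * int q}" for n
  proof -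
    define k where "k = nat (n + int (2 * q))"
    have k: "int k = n + 2 * int q" "k \<le> 4 * q"
      using n by (auto simp: k_def)
    have "int (k mod q) = n mod int q"
      by (simp add: zmod_int k(1))
    then have "nat (n mod int q) = k mod q" by linarith
    moreover have "int_iterate T n ((T ^^ (2 * q)) \<omega>) = (T ^^ k) \<omega>"
      using n unfolding k_def by (intro int_iterate_funpow assms) auto
    ultimately show ?thesis
      using per[OF k(2)] by simp
  qed
  have "f (int_iterate T (n mod int q) ((T ^^ (2 * q)) \<omega>)) = f (int_iterate T n ((T ^^ (2 * q)) \<omega>))"
    if n: "n \<in> {- 2 * int q..2 * int q}" for n
  proof -
    have "0 \<le> n mod int q" "n mod int q < int q"
      using assms(2) by auto
    then have "n mod int q \<in> {- 2 * int q..2 * int q}" by simp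
    then show ?thesis
      using eq[of n] eq[of "n mod int q"] n by simp
  qed
  then show ?thesis
    using assms(3) by (simp add: almost_periodic_window_def)
qed

lemma dense_almost_periodic_windows:
  fixes T :: "'a::metric_space \<Rightarrow> 'a"
  assumes "compact (UNIV :: 'a set)" "bij T" "TRP T" and \<delta>: "\<And>q. \<delta> q > 0"
  shows "closure (\<Union>q\<in>{max 1 m..}. almost_periodic_window T q (\<delta> q)) = UNIV"
proof -
  have "\<exists>p\<in>(\<Union>q\<in>{max 1 m..}. almost_periodic_window T q (\<delta> q)). dist p (f0, \<omega>0) < e"
    if "e > 0" for f0 :: "'a \<Rightarrow>\<^sub>C real" and \<omega>0 and e :: real
  proof -
    have "\<omega>0 \<in> closure (PRP T)"
      using \<open>TRP T\<close> by (simp add: TRP_def)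
    then obtain \<omega> where \<omega>: "\<omega> \<in> PRP T" "dist \<omega> \<omega>0 < e / 3"
      using \<open>e > 0\<close> unfolding closure_approachable by (meson divide_pos_pos zero_less_numeral)
    have "inj T" "e / 3 > 0"
      using \<open>bij T\<close> \<open>e > 0\<close> by (auto simp: bij_is_inj)
    then obtain q f where q: "q \<ge> 1" "q \<ge> m" "dist f f0 < e / 3"
      "dist ((T ^^ (2 * q)) \<omega>) \<omega> < e / 3"
      "\<And>n. n \<le> 4 * q \<Longrightarrow> apply_bcontfun f ((T ^^ n) \<omega>) = f ((T ^^ (n mod q)) \<omega>)"
      using periodic_window_near_PRP_point[OF assms(1) _ \<omega>(1)] by metis
    have "(f, (T ^^ (2 * q)) \<omega>) \<in> almost_periodic_window T q (\<delta> q)"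
      by (rule almost_periodic_window_recentre[OF \<open>bij T\<close> q(1) \<delta> q(5)])
    moreover have "dist (f, (T ^^ (2 * q)) \<omega>) (f0, \<omega>0) \<le> dist f f0 + dist ((T ^^ (2 * q)) \<omega>) \<omega>0"
      by (simp add: dist_Pair_Pair sqrt_sum_squares_le_sum)
    moreover have "dist ((T ^^ (2 * q)) \<omega>) \<omega>0 < 2 * e / 3"
      using q(4) \<omega>(2) dist_triangle[of "(T ^^ (2 * q)) \<omega>" \<omega>0 \<omega>] by linarith
    ultimately show ?thesis
      using q(1-3) by (intro bexI[of _ "(f, (T ^^ (2 * q)) \<omega>)"]) auto
  qed
  then show ?thesis
    by (auto simp: set_eq_iff closure_approachable split_paired_all)
qed

text \<open>Extending one period of the window periodically gives the approximants.\<close>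

lemma gordon_potential_if_almost_periodic_windows:
  fixes f :: "'a::metric_space \<Rightarrow>\<^sub>C real"
  assumes "\<And>m. m \<ge> 1 \<Longrightarrow> \<exists>q\<ge>max 1 m. (f, \<omega>) \<in> almost_periodic_window T q (real m powi (- int q))"
  shows "gordon_potential (\<lambda>n. f (int_iterate T n \<omega>))"
proof -
  let ?V = "\<lambda>n. f (int_iterate T n \<omega>)"
  obtain p where p: "\<And>m. m \<ge> 1 \<Longrightarrow> p m \<ge> 1" "\<And>m. m \<ge> 1 \<Longrightarrow> p m \<ge> m"
    "\<And>m. m \<ge> 1 \<Longrightarrow> (f, \<omega>) \<in> almost_periodic_window T (p m) (real m powi (- int (p m)))"
    using assms by (metis max.bounded_iff)
  define W where "W m n = ?V (n mod int (p m))" for m n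
  have bound: "\<bar>f y\<bar> \<le> norm f" for y
    using norm_bounded[of f y] by simp
  have "bounded (range ?V)"
    using bound by (intro boundedI[of _ "norm f"]) auto
  moreover have "filterlim p at_top sequentially"
    using p(2) by (intro filterlim_at_top_mono[OF filterlim_ident] eventually_sequentiallyI[of 1])
  moreover have "W m (n + int (p m)) = W m n" for m n
    by (simp add: W_def)
  moreover have "bdd_above {\<bar>W m n\<bar> | m n. m \<ge> 1}"
    using bound by (intro bdd_aboveI[of _ "norm f"]) (auto simp: W_def)
  moreover have "(SUP n\<in>{n. \<bar>n\<bar> \<le> 2 * int (p m)}. \<bar>W m n - ?V n\<bar>) \<le> 1 * real m powi (- int (p m))"
    if "m \<ge> 1" for m
  proof (rule cSUP_least)
    have "(0 :: int) \<in> {n. \<bar>n\<bar> \<le> 2 * int (p m)}" by simp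
    then show "{n. \<bar>n\<bar> \<le> 2 * int (p m)} \<noteq> {}" by blast
    show "\<bar>W m n - ?V n\<bar> \<le> 1 * real m powi (- int (p m))"
      if "n \<in> {n. \<bar>n\<bar> \<le> 2 * int (p m)}" for n
    proof -
      have "n \<in> {- 2 * int (p m)..2 * int (p m)}"
        using that by auto
      then show ?thesis
        using p(3)[OF \<open>m \<ge> 1\<close>] by (simp add: W_def almost_periodic_window_def less_imp_le)
    qed
  qed
  ultimately show ?thesis
    unfolding gordon_potential_def using p(1)
    by (intro conjI exI[of _ p] exI[of _ W] exI[of _ "1 :: real"]) auto
qed

section \<open>Generic Gordon potentials\<close>

theorem theoremB:
  fixes T :: "'a::metric_space \<Rightarrow> 'a"
  assumes "compact (UNIV :: 'a set)"
    and "homeomorphism UNIV UNIV T (inv T)"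
    and "\<exists>\<mu>. invariant_borel_prob T \<mu> \<and> ergodic T \<mu>"
    and "TRP T"
  shows "\<exists>\<F> :: ('a \<Rightarrow>\<^sub>C real) set. residual \<F> \<and>
           (\<forall>f\<in>\<F>. \<exists>\<Omega>\<^sub>f. residual \<Omega>\<^sub>f \<and>
              (\<forall>\<omega>\<in>\<Omega>\<^sub>f. gordon_potential (\<lambda>n. apply_bcontfun f (int_iterate T n \<omega>))))"
proof -
  have "bij T"
    using assms(2) unfolding homeomorphism_def by (metis UNIV_I bijI')
  define G where
    "G m = (\<Union>q\<in>{max 1 m..}. almost_periodic_window T q (real m powi (- int q)))" for m
  define R where "R = (\<Inter>m\<in>{1..}. G m)"
  have "open (G m) \<and> closure (G m) = UNIV" if "m \<in> {1..}" for m
  proof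
    show "open (G m)"
      unfolding G_def by (intro open_UN ballI open_almost_periodic_window assms(2))
    show "closure (G m) = UNIV"
      unfolding G_def using that
      by (intro dense_almost_periodic_windows assms(1,4) \<open>bij T\<close> zero_less_power_int) auto
  qed
  then have "residual R"
    unfolding residual_def R_def by (intro exI[of _ "G ` {1..}"]) auto
  obtain B :: "'a set set" where "countable B" "topological_basis B"
    using compact_metric_countable_basis[OF assms(1)] .
  then have "residual {f. residual {\<omega>. (f, \<omega>) \<in> R}}"
    using \<open>residual R\<close> by (rule Kuratowski_Ulam)
  moreover have "gordon_potential (\<lambda>n. apply_bcontfun f (int_iterate T n \<omega>))" if "(f, \<omega>) \<in> R" for f \<omega>
    using that by (intro gordon_potential_if_almost_periodic_windows) (auto simp: R_def G_def)
  ultimately show ?thesis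
    by (intro exI[of _ "{f. residual {\<omega>. (f, \<omega>) \<in> R}}"]) auto
qed

end
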